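(* Let $\mathcal{H}$ be a Hilbert space. The Banach space $\mathcal{L}(\mathcal{H},\mathcal{H})$ of all bounded linear operators on $\mathcal{H}$ has no Schauder frame.
   Context: Banach spaces are over $\mathbb{K}\in\{\mathbb{R},\mathbb{C}\}$; $X^*$ denotes the topological dual of a Banach space $X$. A Schauder frame of a Banach space $X$ is a sequence $\{(x_n,f_n)\}_{n\ge 1}\subset X\times X^*$ such that for every $x\in X$ the series $\sum_n f_n(x)x_n$ converges in $X$ to $x$.
   Formalization: The Hilbert space H is assumed infinite-dimensional; for every finite-dimensional H the claim is false, since a basis of L(H,H) with its dual basis, padded by zeros, is a Schauder frame. *)

theory Defs
  imports "HOL-Analysis.Analysis"
begin

section \<open>Complex normed, Banach and Hilbert spaces\<close>

text \<open>
  The distribution has type classes for real normed and inner product spaces only. As there, the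
  complex classes keep the real scalar multiplication; it is the restriction of the complex one.
\<close>

class complex_vector = real_vector +
  fixes scaleC :: "complex \<Rightarrow> 'a \<Rightarrow> 'a"  (infixr "*\<^sub>C" 75)
  assumes scaleC_add_right: "a *\<^sub>C (x + y) = a *\<^sub>C x + a *\<^sub>C y"
    and scaleC_add_left: "(a + b) *\<^sub>C x = a *\<^sub>C x + b *\<^sub>C x"
    and scaleC_scaleC: "a *\<^sub>C b *\<^sub>C x = (a * b) *\<^sub>C x"
    and scaleC_one: "1 *\<^sub>C x = x"
    and scaleR_scaleC: "r *\<^sub>R x = complex_of_real r *\<^sub>C x"

global_interpretation complex_vector: vector_space "scaleC :: complex \<Rightarrow> 'a \<Rightarrow> 'a::complex_vector"
  defines cspan = complex_vector.span
  by unfold_locales (fact scaleC_add_right scaleC_add_left scaleC_scaleC scaleC_one)+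

class complex_normed_vector = complex_vector + real_normed_vector +
  assumes norm_scaleC: "norm (a *\<^sub>C x) = cmod a * norm x"

class cbanach = complex_normed_vector + banach

class complex_inner = complex_normed_vector +
  fixes cinner :: "'a \<Rightarrow> 'a \<Rightarrow> complex"
  assumes cinner_commute: "cinner x y = cnj (cinner y x)"
    and cinner_add_left: "cinner (x + y) z = cinner x z + cinner y z"
    and cinner_scaleC_left: "cinner (a *\<^sub>C x) y = a * cinner x y"
    and cinner_ge_zero: "0 \<le> Re (cinner x x)"
    and cinner_eq_zero_iff: "cinner x x = 0 \<longleftrightarrow> x = 0"
    and norm_eq_sqrt_cinner: "norm x = sqrt (Re (cinner x x))"

class chilbert_space = complex_inner + complete_space
begin
subclass cbanach ..
end

instantiation complex :: cbanach
begin
definition scaleC_complex :: "complex \<Rightarrow> complex \<Rightarrow> complex"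
  where "scaleC_complex a x = a * x"
instance
  by standard (simp_all add: scaleC_complex_def algebra_simps norm_mult scaleR_conv_of_real)
end

instantiation complex :: chilbert_space
begin
definition cinner_complex :: "complex \<Rightarrow> complex \<Rightarrow> complex"
  where "cinner_complex x y = x * cnj y"
instance
  by standard
    (auto simp: cinner_complex_def scaleC_complex_def algebra_simps cmod_def power2_eq_square)
end


section \<open>Bounded complex-linear operators\<close>

definition bounded_clinear :: "('a::complex_normed_vector \<Rightarrow> 'b::complex_normed_vector) \<Rightarrow> bool"
  where "bounded_clinear f \<longleftrightarrow> bounded_linear f \<and> (\<forall>a x. f (a *\<^sub>C x) = a *\<^sub>C f x)"

lemma scaleC_right_bounded_linear:
  "bounded_linear (\<lambda>x::'a::complex_normed_vector. a *\<^sub>C x)"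
  by (rule bounded_linear_intro[where K = "cmod a"])
    (simp_all add: scaleC_add_right scaleR_scaleC scaleC_scaleC mult.commute norm_scaleC)

lemma scaleC_zero_right [simp]: "a *\<^sub>C (0::'a::complex_vector) = 0"
  by (rule complex_vector.scale_zero_right)

lemma bounded_clinear_zero: "bounded_clinear (\<lambda>x. 0)"
  by (simp add: bounded_clinear_def bounded_linear_zero)

lemma bounded_clinear_add:
  "bounded_clinear f \<Longrightarrow> bounded_clinear g \<Longrightarrow> bounded_clinear (\<lambda>x. f x + g x)"
  by (simp add: bounded_clinear_def bounded_linear_add scaleC_add_right)

lemma bounded_clinear_minus: "bounded_clinear f \<Longrightarrow> bounded_clinear (\<lambda>x. - f x)"
  by (simp add: bounded_clinear_def bounded_linear_minus complex_vector.scale_minus_right)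

lemma bounded_clinear_diff:
  "bounded_clinear f \<Longrightarrow> bounded_clinear g \<Longrightarrow> bounded_clinear (\<lambda>x. f x - g x)"
  by (simp add: bounded_clinear_def bounded_linear_sub complex_vector.scale_right_diff_distrib)

lemma bounded_clinear_scaleC: "bounded_clinear f \<Longrightarrow> bounded_clinear (\<lambda>x. a *\<^sub>C f x)"
  by (auto simp: bounded_clinear_def scaleC_scaleC mult.commute
      intro: bounded_linear_compose[OF scaleC_right_bounded_linear])

lemma bounded_clinear_scaleR: "bounded_clinear f \<Longrightarrow> bounded_clinear (\<lambda>x. r *\<^sub>R f x)"
  unfolding scaleR_scaleC by (rule bounded_clinear_scaleC)

typedef (overloaded) ('a, 'b) cblinfun  ("(_ \<Rightarrow>\<^sub>C\<^sub>L /_)" [22, 21] 21) =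
  "{f :: 'a::complex_normed_vector \<Rightarrow> 'b::complex_normed_vector. bounded_clinear f}"
  morphisms cblinfun_apply CBlinfun
  using bounded_clinear_zero by blast

setup_lifting type_definition_cblinfun

instantiation cblinfun :: (complex_normed_vector, complex_normed_vector) complex_normed_vector
begin

lift_definition norm_cblinfun :: "'a \<Rightarrow>\<^sub>C\<^sub>L 'b \<Rightarrow> real" is onorm .

lift_definition zero_cblinfun :: "'a \<Rightarrow>\<^sub>C\<^sub>L 'b" is "\<lambda>x. 0"
  by (rule bounded_clinear_zero)

lift_definition plus_cblinfun :: "'a \<Rightarrow>\<^sub>C\<^sub>L 'b \<Rightarrow> 'a \<Rightarrow>\<^sub>C\<^sub>L 'b \<Rightarrow> 'a \<Rightarrow>\<^sub>C\<^sub>L 'b" is "\<lambda>f g x. f x + g x"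
  by (rule bounded_clinear_add)

lift_definition uminus_cblinfun :: "'a \<Rightarrow>\<^sub>C\<^sub>L 'b \<Rightarrow> 'a \<Rightarrow>\<^sub>C\<^sub>L 'b" is "\<lambda>f x. - f x"
  by (rule bounded_clinear_minus)

lift_definition minus_cblinfun :: "'a \<Rightarrow>\<^sub>C\<^sub>L 'b \<Rightarrow> 'a \<Rightarrow>\<^sub>C\<^sub>L 'b \<Rightarrow> 'a \<Rightarrow>\<^sub>C\<^sub>L 'b" is "\<lambda>f g x. f x - g x"
  by (rule bounded_clinear_diff)

lift_definition scaleR_cblinfun :: "real \<Rightarrow> 'a \<Rightarrow>\<^sub>C\<^sub>L 'b \<Rightarrow> 'a \<Rightarrow>\<^sub>C\<^sub>L 'b" is "\<lambda>r f x. r *\<^sub>R f x"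
  by (rule bounded_clinear_scaleR)

lift_definition scaleC_cblinfun :: "complex \<Rightarrow> 'a \<Rightarrow>\<^sub>C\<^sub>L 'b \<Rightarrow> 'a \<Rightarrow>\<^sub>C\<^sub>L 'b" is "\<lambda>a f x. a *\<^sub>C f x"
  by (rule bounded_clinear_scaleC)

definition dist_cblinfun :: "'a \<Rightarrow>\<^sub>C\<^sub>L 'b \<Rightarrow> 'a \<Rightarrow>\<^sub>C\<^sub>L 'b \<Rightarrow> real"
  where "dist_cblinfun S T = norm (S - T)"

definition sgn_cblinfun :: "'a \<Rightarrow>\<^sub>C\<^sub>L 'b \<Rightarrow> 'a \<Rightarrow>\<^sub>C\<^sub>L 'b"
  where "sgn_cblinfun T = scaleR (inverse (norm T)) T"

definition [code del]:
  "(uniformity :: (('a \<Rightarrow>\<^sub>C\<^sub>L 'b) \<times> ('a \<Rightarrow>\<^sub>C\<^sub>L 'b)) filter)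
    = (INF e\<in>{0 <..}. principal {(S, T). dist S T < e})"

definition [code del]:
  "open_cblinfun (U :: ('a \<Rightarrow>\<^sub>C\<^sub>L 'b) set)
    \<longleftrightarrow> (\<forall>T\<in>U. eventually (\<lambda>(T', S). T' = T \<longrightarrow> S \<in> U) uniformity)"

lemma onorm_scaleC:
  assumes "bounded_linear (f :: 'a \<Rightarrow> 'b)"
  shows "onorm (\<lambda>x. a *\<^sub>C f x) = cmod a * onorm f"
proof -
  have "onorm (\<lambda>x. a *\<^sub>C f x) = onorm (\<lambda>x. cmod a *\<^sub>R f x)"
    by (simp add: onorm_def norm_scaleC)
  with assms show ?thesis
    by (simp add: onorm_scaleR)
qed

instance
proof
  fix S T U :: "'a \<Rightarrow>\<^sub>C\<^sub>L 'b" and a b :: complex and r s :: real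
  show "S + T + U = S + (T + U)" "S + T = T + S" "0 + S = S" "- S + S = 0" "S - T = S + - T"
    by (transfer, simp add: algebra_simps)+
  show "r *\<^sub>R (S + T) = r *\<^sub>R S + r *\<^sub>R T" "(r + s) *\<^sub>R S = r *\<^sub>R S + s *\<^sub>R S"
    "r *\<^sub>R s *\<^sub>R S = (r * s) *\<^sub>R S" "1 *\<^sub>R S = S"
    by (transfer, simp add: algebra_simps)+
  show "a *\<^sub>C (S + T) = a *\<^sub>C S + a *\<^sub>C T" "(a + b) *\<^sub>C S = a *\<^sub>C S + b *\<^sub>C S"
    "a *\<^sub>C b *\<^sub>C S = (a * b) *\<^sub>C S" "1 *\<^sub>C S = S"
    by (transfer, simp add: scaleC_add_right scaleC_add_left scaleC_scaleC scaleC_one)+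
  show "r *\<^sub>R S = complex_of_real r *\<^sub>C S"
    by (transfer, simp add: scaleR_scaleC)
  show "norm S = 0 \<longleftrightarrow> S = 0"
    by (transfer, auto simp: bounded_clinear_def onorm_eq_0)
  show "norm (S + T) \<le> norm S + norm T"
    by (transfer, simp add: bounded_clinear_def onorm_triangle)
  show "norm (r *\<^sub>R S) = \<bar>r\<bar> * norm S"
    by (transfer, simp add: bounded_clinear_def onorm_scaleR)
  show "norm (a *\<^sub>C S) = cmod a * norm S"
    by (transfer, simp add: bounded_clinear_def onorm_scaleC)
qed (simp_all add: dist_cblinfun_def sgn_cblinfun_def uniformity_cblinfun_def open_cblinfun_def)

end

lift_definition blinfun_of_cblinfun ::
  "('a::complex_normed_vector \<Rightarrow>\<^sub>C\<^sub>L 'b::complex_normed_vector) \<Rightarrow> ('a \<Rightarrow>\<^sub>L 'b)" is "\<lambda>f. f"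
  by (simp add: bounded_clinear_def)

lemma dist_blinfun_of_cblinfun: "dist (blinfun_of_cblinfun S) (blinfun_of_cblinfun T) = dist S T"
  unfolding dist_norm by transfer simp

lemma blinfun_of_cblinfun_scaleC:
  "blinfun_apply (blinfun_of_cblinfun T) (a *\<^sub>C x) = a *\<^sub>C blinfun_apply (blinfun_of_cblinfun T) x"
  by transfer (simp add: bounded_clinear_def)

instance cblinfun :: (complex_normed_vector, cbanach) cbanach
proof
  fix X :: "nat \<Rightarrow> 'a \<Rightarrow>\<^sub>C\<^sub>L 'b"
  assume "Cauchy X"
  then have "Cauchy (\<lambda>n. blinfun_of_cblinfun (X n))"
    by (simp add: Cauchy_def dist_blinfun_of_cblinfun)
  then obtain L where L: "(\<lambda>n. blinfun_of_cblinfun (X n)) \<longlonglongrightarrow> L"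
    by (metis Cauchy_convergent convergentD)
  have pt: "(\<lambda>n. blinfun_apply (blinfun_of_cblinfun (X n)) x) \<longlonglongrightarrow> blinfun_apply L x" for x
    by (intro tendsto_intros L)
  have "blinfun_apply L (a *\<^sub>C x) = a *\<^sub>C blinfun_apply L x" for a x
  proof (rule LIMSEQ_unique[OF pt])
    show "(\<lambda>n. blinfun_apply (blinfun_of_cblinfun (X n)) (a *\<^sub>C x)) \<longlonglongrightarrow> a *\<^sub>C blinfun_apply L x"
      unfolding blinfun_of_cblinfun_scaleC
      by (rule bounded_linear.tendsto[OF scaleC_right_bounded_linear pt])
  qed
  then have "bounded_clinear (blinfun_apply L)"
    by (simp add: bounded_clinear_def blinfun.bounded_linear_right)
  then have "blinfun_of_cblinfun (CBlinfun (blinfun_apply L)) = L"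
    by (intro blinfun_eqI)
      (simp add: blinfun_of_cblinfun.rep_eq CBlinfun_inverse)
  with L have "X \<longlonglongrightarrow> CBlinfun (blinfun_apply L)"
    by (metis (no_types, lifting) dist_blinfun_of_cblinfun lim_sequentially)
  then show "convergent X"
    by (rule convergentI)
qed


section \<open>Schauder frames\<close>

definition schauder_frame ::
    "(nat \<Rightarrow> 'a::banach \<times> ('a \<Rightarrow>\<^sub>L real)) \<Rightarrow> bool"
  where "schauder_frame F \<longleftrightarrow>
    (\<forall>x. (\<lambda>n. blinfun_apply (snd (F n)) x *\<^sub>R fst (F n)) sums x)"

definition complex_schauder_frame ::
    "(nat \<Rightarrow> 'a::cbanach \<times> ('a \<Rightarrow>\<^sub>C\<^sub>L complex)) \<Rightarrow> bool"
  where "complex_schauder_frame F \<longleftrightarrow>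
    (\<forall>x. (\<lambda>n. cblinfun_apply (snd (F n)) x *\<^sub>C fst (F n)) sums x)"

end

theory Submission
  imports Defs
begin

text \<open>
  A Schauder frame makes its space separable: every vector is a limit of finite linear combinations
  of the \<open>x\<^sub>n\<close>, and the coefficients may be moved into a countable dense set of scalars
  (\<open>countable_dense_of_expansions\<close>). The space of bounded operators on an infinite-dimensional
  Hilbert space is not separable. For an orthonormal sequence \<open>e\<close> and a set \<open>A\<close> of indices, let
  \<open>P\<^sub>A\<close> be the orthogonal projection onto the closed span of the \<open>e n\<close> with \<open>n \<in> A\<close>. If \<open>n\<close>
  belongs to exactly one of \<open>A\<close> and \<open>B\<close>, then \<open>P\<^sub>A - P\<^sub>B\<close> maps the unit vector \<open>e n\<close> to
  \<open>\<plusminus> e n\<close>. So the \<open>P\<^sub>A\<close> are uncountably many points at mutual distance at least 1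
  (\<open>exists_separated_projections\<close>), which a separable space cannot contain
  (\<open>no_countable_dense_if_separated\<close>).

  The Hilbert space argument uses only a few algebraic laws of the inner product, so it is carried
  out once, for both scalar fields, in the locale \<open>hilbert\<close>.
\<close>

section \<open>Separability of spaces with series expansions\<close>

text \<open>
  The countable dense set consists of the finite sums with coefficients in a countable dense set of
  scalars; in a sum of \<open>N\<close> terms each term may be perturbed by \<open>\<epsilon> / (2 (N + 1))\<close>, where the
  \<open>+ 1\<close> covers the empty sum. A general term \<open>g n c\<close> covers real and complex multiples of \<open>x\<^sub>n\<close>
  at once.
\<close>

lemma countable_dense_of_expansions:
  fixes g :: "nat \<Rightarrow> 's::second_countable_topology \<Rightarrow> 'a::real_normed_vector"
  assumes cont: "\<And>n. continuous_on UNIV (g n)"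
    and expand: "\<And>x. \<exists>c. (\<lambda>n. g n (c n)) sums x"
  shows "\<exists>D :: 'a set. countable D \<and> (\<forall>x. \<forall>\<epsilon>>0. \<exists>d\<in>D. dist d x < \<epsilon>)"
proof -
  obtain Q :: "'s set" where Q: "countable Q"
    and dense: "\<And>U. open U \<Longrightarrow> U \<noteq> {} \<Longrightarrow> \<exists>q\<in>Q. q \<in> U"
    using countable_dense_setE by metis
  define D where "D = (\<Union>N. (\<lambda>c. \<Sum>n<N. g n (c n)) ` ({..<N} \<rightarrow>\<^sub>E Q))"
  have "countable D"
    unfolding D_def using Q by (intro countable_UN countable_image countable_PiE) auto
  moreover have "\<exists>d\<in>D. dist d x < \<epsilon>" if \<epsilon>: "0 < \<epsilon>" for x \<epsilon>
  proof -
    obtain c where "(\<lambda>n. g n (c n)) sums x"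
      using expand by blast
    then obtain N where N: "dist (\<Sum>n<N. g n (c n)) x < \<epsilon> / 2"
      unfolding sums_def lim_sequentially using half_gt_zero[OF \<epsilon>] by blast
    define \<delta> where "\<delta> = \<epsilon> / (2 * (real N + 1))"
    have \<delta>: "0 < \<delta>"
      using \<epsilon> by (simp add: \<delta>_def)
    have "\<exists>q\<in>Q. dist (g n q) (g n (c n)) < \<delta>" for n
    proof -
      have "open (g n -` ball (g n (c n)) \<delta>)"
        using cont[of n] by (intro open_vimage) auto
      moreover have "c n \<in> g n -` ball (g n (c n)) \<delta>"
        using \<delta> by simp
      ultimately have "\<exists>q\<in>Q. q \<in> g n -` ball (g n (c n)) \<delta>"
        using dense by blast
      then show ?thesis
        by (auto simp: dist_commute)
    qed
    then obtain q where q: "\<And>n. q n \<in> Q" "\<And>n. dist (g n (q n)) (g n (c n)) < \<delta>"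
      by metis
    let ?d = "\<Sum>n<N. g n (q n)"
    have "?d \<in> D"
    proof -
      have "?d = (\<Sum>n<N. g n (restrict q {..<N} n))"
        by (intro sum.cong) auto
      moreover have "restrict q {..<N} \<in> {..<N} \<rightarrow>\<^sub>E Q"
        using q(1) by auto
      ultimately have "?d \<in> (\<lambda>c. \<Sum>n<N. g n (c n)) ` ({..<N} \<rightarrow>\<^sub>E Q)"
        by (rule image_eqI)
      then show ?thesis
        unfolding D_def by blast
    qed
    moreover have "dist ?d x < \<epsilon>"
    proof -
      have "dist ?d (\<Sum>n<N. g n (c n)) = norm (\<Sum>n<N. g n (q n) - g n (c n))"
        by (simp only: dist_norm sum_subtractf)
      also have "\<dots> \<le> (\<Sum>n<N. \<delta>)"
        using q(2) by (intro sum_norm_le) (simp add: dist_norm less_imp_le)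
      also have "\<dots> \<le> \<epsilon> / 2"
        using \<epsilon> by (simp add: \<delta>_def field_simps)
      finally show ?thesis
        using N dist_triangle[of ?d x "\<Sum>n<N. g n (c n)"] by linarith
    qed
    ultimately show ?thesis
      by blast
  qed
  ultimately show ?thesis
    by blast
qed

text \<open>
  Points of the dense set within \<open>1/2\<close> of \<open>T A\<close> and of \<open>T B\<close> differ, so the dense set would admit
  an injection from the power set of the natural numbers.
\<close>

lemma no_countable_dense_if_separated:
  fixes T :: "nat set \<Rightarrow> 'a::metric_space"
  assumes sep: "\<And>A B. A \<noteq> B \<Longrightarrow> 1 \<le> dist (T A) (T B)"
    and dense: "\<exists>D :: 'a set. countable D \<and> (\<forall>x. \<forall>\<epsilon>>0. \<exists>d\<in>D. dist d x < \<epsilon>)"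
  shows False
proof -
  obtain D :: "'a set" where D: "countable D"
    and near: "\<forall>x. \<forall>\<epsilon>>0. \<exists>d\<in>D. dist d x < \<epsilon>"
    using dense by blast
  have "\<exists>d\<in>D. dist d (T A) < 1 / 2" for A
    using near[rule_format, of "1 / 2" "T A"] by simp
  then obtain d where d: "\<And>A. d A \<in> D" "\<And>A. dist (d A) (T A) < 1 / 2"
    by metis
  have "inj d"
  proof (rule injI)
    fix A B assume "d A = d B"
    then have "dist (T A) (T B) < 1"
      using d(2)[of A] d(2)[of B] dist_triangle2[of "T A" "T B" "d A"]
      by (simp add: dist_commute)
    then show "A = B"
      using sep[of A B] by linarith
  qed
  moreover have "countable (range d)"
    using D d(1) by (auto intro: countable_subset)
  ultimately have "countable (UNIV :: nat set set)"
    using countable_image_inj_on by blast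
  then have "\<exists>f :: nat \<Rightarrow> nat set. range f = UNIV"
    by (metis UNIV_not_empty uncountable_def)
  then show False
    using Cantors_theorem[of "UNIV :: nat set"] by (metis Pow_UNIV)
qed


section \<open>Coordinate projections in a Hilbert space\<close>

text \<open>
  The laws shared by real and complex Hilbert spaces that the construction needs. Conjugate symmetry
  enters only through the symmetry of orthogonality and additivity in the second argument, so that
  no conjugation has to be postulated on the field of scalars.
\<close>

locale hilbert =
  fixes scale :: "'s::real_normed_field \<Rightarrow> 'a::banach \<Rightarrow> 'a"
    and ip :: "'a \<Rightarrow> 'a \<Rightarrow> 's"
  assumes scale_add_right: "scale a (x + y) = scale a x + scale a y"
    and scale_add_left: "scale (a + b) x = scale a x + scale b x"
    and scale_scale: "scale a (scale b x) = scale (a * b) x"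
    and scaleR_eq_scale: "r *\<^sub>R x = scale (of_real r) x"
    and norm_scale: "norm (scale a x) = norm a * norm x"
    and ip_add_left: "ip (x + y) z = ip x z + ip y z"
    and ip_add_right: "ip x (y + z) = ip x y + ip x z"
    and ip_scale_left: "ip (scale a x) y = a * ip x y"
    and ip_eq_zero_sym: "ip x y = 0 \<Longrightarrow> ip y x = 0"
    and ip_self: "ip x x = of_real ((norm x)\<^sup>2)"
begin

lemma scale_zero_left: "scale 0 x = 0"
  using scale_add_left[of 0 0 x] by simp

lemma scale_zero_right: "scale a 0 = 0"
  using scale_add_right[of a 0 0] by simp

lemma scaleR_scale: "r *\<^sub>R scale a x = scale a (r *\<^sub>R x)"
  by (simp add: scaleR_eq_scale scale_scale mult.commute)

lemma bounded_linear_scale: "bounded_linear (scale a)"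
  by (rule bounded_linear_intro[where K = "norm a"])
    (simp_all add: scale_add_right scaleR_scale norm_scale mult.commute)

lemma ip_zero_left: "ip 0 y = 0"
  using ip_add_left[of 0 0 y] by simp

lemma ip_zero_right: "ip x 0 = 0"
  using ip_zero_left ip_eq_zero_sym by blast

lemma ip_diff_left: "ip (x - y) z = ip x z - ip y z"
  using ip_add_left[of "x - y" y z] by simp

lemma ip_scaleR_left: "ip (r *\<^sub>R x) y = of_real r * ip x y"
  by (simp add: scaleR_eq_scale ip_scale_left)

lemma ip_sum_left: "ip (\<Sum>i\<in>F. f i) y = (\<Sum>i\<in>F. ip (f i) y)"
  by (induction F rule: infinite_finite_induct) (simp_all add: ip_zero_left ip_add_left)

lemma ip_sum_right: "ip x (\<Sum>i\<in>F. f i) = (\<Sum>i\<in>F. ip x (f i))"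
  by (induction F rule: infinite_finite_induct) (simp_all add: ip_zero_right ip_add_right)

lemma pythagoras:
  assumes "ip x y = 0"
  shows "(norm (x + y))\<^sup>2 = (norm x)\<^sup>2 + (norm y)\<^sup>2"
proof -
  have "ip (x + y) (x + y) = ip x x + ip y y"
    using assms ip_eq_zero_sym[OF assms] by (simp add: ip_add_left ip_add_right)
  then have "(of_real ((norm (x + y))\<^sup>2) :: 's) = of_real ((norm x)\<^sup>2 + (norm y)\<^sup>2)"
    by (simp only: ip_self of_real_add)
  then show ?thesis
    by (simp only: of_real_eq_iff)
qed

definition orthonormal :: "'i set \<Rightarrow> ('i \<Rightarrow> 'a) \<Rightarrow> bool"
  where "orthonormal I e \<longleftrightarrow> (\<forall>i\<in>I. \<forall>j\<in>I. ip (e i) (e j) = (if i = j then 1 else 0))"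

abbreviation component :: "('i \<Rightarrow> 'a) \<Rightarrow> 'i \<Rightarrow> 'a \<Rightarrow> 'a"
  where "component e i x \<equiv> scale (ip x (e i)) (e i)"

lemma ip_residual:
  assumes e: "orthonormal F e" and F: "finite F" "j \<in> F"
  shows "ip (x - (\<Sum>i\<in>F. component e i x)) (e j) = 0"
proof -
  have "ip (\<Sum>i\<in>F. component e i x) (e j) = (\<Sum>i\<in>F. if i = j then ip x (e j) else 0)"
    unfolding ip_sum_left
    using e F(2) by (intro sum.cong) (auto simp: ip_scale_left orthonormal_def)
  then show ?thesis
    using F by (simp add: ip_diff_left)
qed

lemma ip_scale_right_eq_zero: "ip x y = 0 \<Longrightarrow> ip x (scale a y) = 0"
  by (metis ip_eq_zero_sym ip_scale_left mult_zero_right)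

lemma norm_sum_components:
  assumes e: "orthonormal F e" and F: "finite F"
  shows "(norm (\<Sum>i\<in>F. component e i x))\<^sup>2 = (\<Sum>i\<in>F. (norm (component e i x))\<^sup>2)"
  using F e
proof (induction F)
  case (insert j F)
  have "ip (component e j x) (\<Sum>i\<in>F. component e i x) = 0"
    unfolding ip_sum_right
    using insert.prems insert.hyps
    by (intro sum.neutral) (auto simp: ip_scale_left orthonormal_def intro!: ip_scale_right_eq_zero)
  then show ?case
    using insert by (simp add: pythagoras orthonormal_def)
qed simp

text \<open>
  Bessel's inequality for the partial sums: the residual is orthogonal to the partial sum, so the
  latter is a leg of a right triangle with hypotenuse \<open>x\<close>.
\<close>

lemma norm_sum_components_le:
  assumes e: "orthonormal F e" and F: "finite F"
  shows "norm (\<Sum>i\<in>F. component e i x) \<le> norm x"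
proof -
  let ?p = "\<Sum>i\<in>F. component e i x"
  have "ip (x - ?p) ?p = 0"
    unfolding ip_sum_right
    by (intro sum.neutral ballI ip_scale_right_eq_zero ip_residual[unfolded ip_sum_right] e F)
  from pythagoras[OF this] have "(norm ?p)\<^sup>2 \<le> (norm x)\<^sup>2"
    by simp
  then show ?thesis
    by (rule power2_le_imp_le) simp
qed

text \<open>
  One Gram--Schmidt step per index: the residual of a vector outside the span of the previous
  \<open>e m\<close> is nonzero and orthogonal to them.
\<close>

lemma exists_orthonormal_sequence:
  assumes inf_dim: "\<And>F :: nat set. \<And>e. finite F \<Longrightarrow> \<exists>x. \<forall>c. x \<noteq> (\<Sum>i\<in>F. scale (c i) (e i))"
  shows "\<exists>e :: nat \<Rightarrow> 'a. orthonormal UNIV e"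
proof -
  have "\<exists>e :: nat \<Rightarrow> 'a. \<forall>n. ip (e n) (e n) = 1 \<and> (\<forall>m<n. ip (e n) (e m) = 0)"
  proof (rule dependent_wellorder_choice)
    fix n :: nat and e :: "nat \<Rightarrow> 'a"
    assume IH: "\<And>m. m < n \<Longrightarrow> ip (e m) (e m) = 1 \<and> (\<forall>k<m. ip (e m) (e k) = 0)"
    have orth: "orthonormal {..<n} e"
      unfolding orthonormal_def
    proof (intro ballI)
      fix i j assume "i \<in> {..<n}" "j \<in> {..<n}"
      then show "ip (e i) (e j) = (if i = j then 1 else 0)"
        using IH[of i] IH[of j] ip_eq_zero_sym[of "e j" "e i"]
        by (cases i j rule: linorder_cases) auto
    qed
    obtain x where x: "\<And>c. x \<noteq> (\<Sum>m<n. scale (c m) (e m))"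
      using inf_dim[of "{..<n}" e] by auto
    define y where "y = x - (\<Sum>m<n. component e m x)"
    have y: "norm y \<noteq> 0"
      using x by (simp add: y_def)
    have y_orth: "ip y (e m) = 0" if "m < n" for m
      unfolding y_def using orth that by (intro ip_residual) auto
    define r where "r = inverse (norm y) *\<^sub>R y"
    have "norm r = 1"
      using y by (simp add: r_def)
    then have "ip r r = 1"
      by (simp add: ip_self)
    moreover have "\<forall>m<n. ip r (e m) = 0"
      using y_orth by (simp add: r_def ip_scaleR_left)
    ultimately show "\<exists>r. ip r r = 1 \<and> (\<forall>m<n. ip r (e m) = 0)"
      by blast
  qed simp
  then obtain e :: "nat \<Rightarrow> 'a"
    where e: "ip (e n) (e n) = 1" "m < n \<Longrightarrow> ip (e n) (e m) = 0" for m n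
    by blast
  have "ip (e i) (e j) = (if i = j then 1 else 0)" for i j
    using e ip_eq_zero_sym[of "e j" "e i"] by (cases i j rule: linorder_cases) auto
  then show ?thesis
    unfolding orthonormal_def by blast
qed

text \<open>
  Bessel's inequality makes the squared norms of the components summable; by the Pythagorean
  identity their tails control the tails of the series of components itself.
\<close>

lemma summable_components:
  assumes e: "orthonormal UNIV e"
  shows "summable (\<lambda>n::nat. if n \<in> A then component e n x else 0)"
proof -
  have orth: "orthonormal F e" for F
    using e by (simp add: orthonormal_def)
  have sum_A: "(\<Sum>n\<in>F. if n \<in> A then component e n x else 0) = (\<Sum>n\<in>F \<inter> A. component e n x)"
    if "finite F" for F
    using that by (simp add: sum.inter_restrict)
  let ?sq = "\<lambda>n. (norm (component e n x))\<^sup>2"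
  have "summable ?sq"
  proof (rule bounded_imp_summable)
    fix n
    have "sum ?sq {..n} = (norm (\<Sum>k\<le>n. component e k x))\<^sup>2"
      by (simp add: norm_sum_components[OF orth])
    also have "\<dots> \<le> (norm x)\<^sup>2"
      by (intro power_mono norm_sum_components_le orth) auto
    finally show "sum ?sq {..n} \<le> (norm x)\<^sup>2" .
  qed simp
  show ?thesis
    unfolding summable_Cauchy
  proof (intro allI impI)
    fix \<epsilon> :: real assume \<epsilon>: "0 < \<epsilon>"
    then obtain N where N: "\<And>m n. N \<le> m \<Longrightarrow> norm (sum ?sq {m..<n}) < \<epsilon>\<^sup>2"
      using \<open>summable ?sq\<close> unfolding summable_Cauchy by (meson zero_less_power)
    have "norm (\<Sum>k=m..<n. if k \<in> A then component e k x else 0) < \<epsilon>" if "N \<le> m" for m n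
    proof -
      have "(norm (\<Sum>k=m..<n. if k \<in> A then component e k x else 0))\<^sup>2 = sum ?sq ({m..<n} \<inter> A)"
        by (simp add: sum_A norm_sum_components[OF orth])
      also have "\<dots> \<le> sum ?sq {m..<n}"
        by (intro sum_mono2) auto
      also have "\<dots> < \<epsilon>\<^sup>2"
        using N[OF that, of n] by (simp add: sum_nonneg)
      finally show ?thesis
        using \<epsilon> by (simp add: power2_less_imp_less)
    qed
    then show "\<exists>N. \<forall>m\<ge>N. \<forall>n. norm (\<Sum>k=m..<n. if k \<in> A then component e k x else 0) < \<epsilon>"
      by blast
  qed
qed

text \<open>
  The witness for \<open>A \<noteq> B\<close> is \<open>e n\<close> with \<open>n\<close> in the symmetric difference. Homogeneity over the full
  field of scalars is recorded because in the complex case the projections must be complex-linear.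
\<close>

lemma exists_separated_projections:
  assumes inf_dim: "\<And>F :: nat set. \<And>e. finite F \<Longrightarrow> \<exists>x. \<forall>c. x \<noteq> (\<Sum>i\<in>F. scale (c i) (e i))"
  shows "\<exists>P :: nat set \<Rightarrow> 'a \<Rightarrow> 'a.
    (\<forall>A. bounded_linear (P A)) \<and> (\<forall>A a x. P A (scale a x) = scale a (P A x)) \<and>
    (\<forall>A B. A \<noteq> B \<longrightarrow> (\<exists>x. norm x = 1 \<and> norm (P A x - P B x) = 1))"
proof -
  obtain e :: "nat \<Rightarrow> 'a" where e: "orthonormal UNIV e"
    using exists_orthonormal_sequence[OF inf_dim] by blast
  define p where "p A x n = (if n \<in> A then component e n x else 0)" for A x n
  define P where "P A x = (\<Sum>n. p A x n)" for A x
  have p: "p A x sums P A x" for A x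
    unfolding P_def p_def by (intro summable_sums summable_components e)
  have bl: "bounded_linear (P A)" for A
  proof (rule bounded_linear_intro[where K = 1])
    fix x y r
    have "p A (x + y) = (\<lambda>n. p A x n + p A y n)"
      by (intro ext) (simp add: p_def ip_add_left scale_add_left)
    then have "p A (x + y) sums (P A x + P A y)"
      using sums_add[OF p[of A x] p[of A y]] by simp
    then show "P A (x + y) = P A x + P A y"
      by (rule sums_unique2[OF p])
    have "p A (r *\<^sub>R x) = (\<lambda>n. r *\<^sub>R p A x n)"
      by (intro ext)
        (simp add: p_def scaleR_eq_scale ip_scale_left scale_scale scale_zero_right)
    then have "p A (r *\<^sub>R x) sums (r *\<^sub>R P A x)"
      using sums_scaleR_right[OF p[of A x], of r] by simp
    then show "P A (r *\<^sub>R x) = r *\<^sub>R P A x"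
      by (rule sums_unique2[OF p])
    have "norm (\<Sum>n<N. p A x n) \<le> norm x" for N
    proof -
      have "(\<Sum>n<N. p A x n) = (\<Sum>n\<in>{..<N} \<inter> A. component e n x)"
        by (simp add: p_def sum.inter_restrict)
      then show ?thesis
        using e by (simp add: norm_sum_components_le orthonormal_def)
    qed
    then show "norm (P A x) \<le> norm x * 1"
      using p[of A x] unfolding sums_def
      by (intro LIMSEQ_le_const2[OF tendsto_norm]) auto
  qed
  have hom: "P A (scale a x) = scale a (P A x)" for A a x
  proof -
    have "p A (scale a x) = (\<lambda>n. scale a (p A x n))"
      by (intro ext) (simp add: p_def ip_scale_left scale_scale scale_zero_right)
    then have "p A (scale a x) sums scale a (P A x)"
      using bounded_linear.sums[OF bounded_linear_scale p[of A x], of a] by simp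
    then show ?thesis
      by (rule sums_unique2[OF p])
  qed
  have scale_one: "scale 1 x = x" for x
    using scaleR_eq_scale[of 1 x] by simp
  have P_e: "P A (e n) = (if n \<in> A then e n else 0)" for A n
  proof -
    have "p A (e n) = (\<lambda>m. if m = n then (if n \<in> A then e n else 0) else 0)"
      using e by (intro ext) (auto simp: p_def orthonormal_def scale_one scale_zero_left)
    then have "p A (e n) sums (if n \<in> A then e n else 0)"
      using sums_single[of n "\<lambda>_. if n \<in> A then e n else 0"] by simp
    then show ?thesis
      by (rule sums_unique2[OF p])
  qed
  have norm_e: "norm (e n) = 1" for n
  proof -
    have "(of_real ((norm (e n))\<^sup>2) :: 's) = of_real 1"
      using e ip_self[of "e n"] by (simp add: orthonormal_def)
    then have "(norm (e n))\<^sup>2 = 1"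
      by (simp only: of_real_eq_iff)
    then show ?thesis
      using power2_eq_imp_eq[of "norm (e n)" 1] by simp
  qed
  have "\<exists>x. norm x = 1 \<and> norm (P A x - P B x) = 1" if AB: "A \<noteq> B" for A B
  proof -
    obtain n where "(n \<in> A) \<noteq> (n \<in> B)"
      using AB by blast
    then show ?thesis
      by (intro exI[of _ "e n"]) (auto simp: P_e norm_e)
  qed
  with bl hom show ?thesis
    by blast
qed

end


section \<open>Operator spaces on Hilbert spaces have no Schauder frame\<close>

lemma no_real_schauder_frame:
  fixes F :: "nat \<Rightarrow> ('h::{real_inner,banach} \<Rightarrow>\<^sub>L 'h) \<times> (('h \<Rightarrow>\<^sub>L 'h) \<Rightarrow>\<^sub>L real)"
  assumes inf_dim: "\<nexists>B :: 'h set. finite B \<and> span B = UNIV"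
    and F: "schauder_frame F"
  shows False
proof -
  interpret hilbert "scaleR :: real \<Rightarrow> 'h \<Rightarrow> 'h" inner
    by unfold_locales
      (simp_all add: scaleR_add_right scaleR_add_left inner_add_left inner_add_right
        inner_commute power2_norm_eq_inner)
  have "\<exists>x. \<forall>c. x \<noteq> (\<Sum>i\<in>I. c i *\<^sub>R e i)" if "finite I" for I :: "nat set" and e :: "nat \<Rightarrow> 'h"
  proof -
    obtain x where "x \<notin> span (e ` I)"
      using inf_dim \<open>finite I\<close> by blast
    moreover have "(\<Sum>i\<in>I. c i *\<^sub>R e i) \<in> span (e ` I)" for c
      by (intro span_sum span_scale span_base) auto
    ultimately show ?thesis
      by metis
  qed
  from exists_separated_projections[OF this]
  obtain P :: "nat set \<Rightarrow> 'h \<Rightarrow> 'h" where P: "\<And>A. bounded_linear (P A)"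
    and sep: "\<And>A B. A \<noteq> B \<Longrightarrow> \<exists>x. norm x = 1 \<and> norm (P A x - P B x) = 1"
    by blast
  have "1 \<le> dist (Blinfun (P A)) (Blinfun (P B))" if AB: "A \<noteq> B" for A B
  proof -
    obtain x where x: "norm x = 1" "norm (P A x - P B x) = 1"
      using sep[OF AB] by blast
    then show ?thesis
      using norm_blinfun[of "Blinfun (P A) - Blinfun (P B)" x]
      by (simp add: dist_norm minus_blinfun.rep_eq bounded_linear_Blinfun_apply P)
  qed
  moreover have "\<exists>D :: ('h \<Rightarrow>\<^sub>L 'h) set. countable D \<and> (\<forall>x. \<forall>\<epsilon>>0. \<exists>d\<in>D. dist d x < \<epsilon>)"
  proof (rule countable_dense_of_expansions)
    show "continuous_on UNIV (\<lambda>c. c *\<^sub>R fst (F n))" for n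
      by (intro continuous_intros)
    show "\<exists>c. (\<lambda>n. c n *\<^sub>R fst (F n)) sums x" for x
      by (rule exI[where x = "\<lambda>n. blinfun_apply (snd (F n)) x"])
        (rule F[unfolded schauder_frame_def, rule_format])
  qed
  ultimately show False
    by (rule no_countable_dense_if_separated)
qed

lemma no_complex_schauder_frame:
  fixes F :: "nat \<Rightarrow> ('k::chilbert_space \<Rightarrow>\<^sub>C\<^sub>L 'k) \<times> (('k \<Rightarrow>\<^sub>C\<^sub>L 'k) \<Rightarrow>\<^sub>C\<^sub>L complex)"
  assumes inf_dim: "\<nexists>B :: 'k set. finite B \<and> cspan B = UNIV"
    and F: "complex_schauder_frame F"
  shows False
proof -
  have cinner_self: "cinner x x = complex_of_real ((norm x)\<^sup>2)" for x :: 'k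
  proof (rule complex_eqI)
    have "Im (cinner x x) = - Im (cinner x x)"
      using arg_cong[OF cinner_commute[of x x], of Im] by simp
    then show "Im (cinner x x) = Im (complex_of_real ((norm x)\<^sup>2))"
      by simp
  qed (simp add: norm_eq_sqrt_cinner cinner_ge_zero)
  have cinner_add_right: "cinner x (y + z) = cinner x y + cinner x z" for x y z :: 'k
    by (metis cinner_add_left cinner_commute complex_cnj_add)
  have cinner_zero_sym: "cinner y x = 0" if "cinner x y = 0" for x y :: 'k
    using that cinner_commute[of y x] by simp
  interpret hilbert "scaleC :: complex \<Rightarrow> 'k \<Rightarrow> 'k" cinner
    by unfold_locales
      (fact scaleC_add_right scaleC_add_left scaleC_scaleC scaleR_scaleC norm_scaleC
        cinner_add_left cinner_add_right cinner_scaleC_left cinner_zero_sym cinner_self)+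
  have "\<exists>x. \<forall>c. x \<noteq> (\<Sum>i\<in>I. c i *\<^sub>C e i)" if "finite I" for I :: "nat set" and e :: "nat \<Rightarrow> 'k"
  proof -
    obtain x where "x \<notin> cspan (e ` I)"
      using inf_dim \<open>finite I\<close> by blast
    moreover have "(\<Sum>i\<in>I. c i *\<^sub>C e i) \<in> cspan (e ` I)" for c
      by (intro complex_vector.span_sum complex_vector.span_scale complex_vector.span_base) auto
    ultimately show ?thesis
      by metis
  qed
  from exists_separated_projections[OF this]
  obtain P :: "nat set \<Rightarrow> 'k \<Rightarrow> 'k" where P: "\<And>A. bounded_linear (P A)"
    and hom: "\<And>A a x. P A (a *\<^sub>C x) = a *\<^sub>C P A x"
    and sep: "\<And>A B. A \<noteq> B \<Longrightarrow> \<exists>x. norm x = 1 \<and> norm (P A x - P B x) = 1"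
    by blast
  have apply_P: "cblinfun_apply (CBlinfun (P A)) = P A" for A
    using P hom by (intro CBlinfun_inverse) (simp add: bounded_clinear_def)
  have "1 \<le> dist (CBlinfun (P A)) (CBlinfun (P B))" if AB: "A \<noteq> B" for A B
  proof -
    obtain x where x: "norm x = 1" "norm (P A x - P B x) = 1"
      using sep[OF AB] by blast
    have "norm (P A x - P B x) \<le> onorm (\<lambda>x. P A x - P B x) * norm x"
      by (rule onorm[OF bounded_linear_sub[OF P P]])
    with x show ?thesis
      by (simp add: dist_norm norm_cblinfun.rep_eq minus_cblinfun.rep_eq apply_P)
  qed
  moreover have "\<exists>D :: ('k \<Rightarrow>\<^sub>C\<^sub>L 'k) set. countable D \<and> (\<forall>x. \<forall>\<epsilon>>0. \<exists>d\<in>D. dist d x < \<epsilon>)"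
  proof (rule countable_dense_of_expansions)
    show "continuous_on UNIV (\<lambda>c. c *\<^sub>C fst (F n))" for n
    proof (rule linear_continuous_on)
      show "bounded_linear (\<lambda>c. c *\<^sub>C fst (F n))"
        by (rule bounded_linear_intro[where K = "norm (fst (F n))"])
          (simp_all add: scaleC_add_left scaleR_scaleC scaleC_scaleC norm_scaleC
            scaleR_conv_of_real scaleC_complex_def)
    qed
    show "\<exists>c. (\<lambda>n. c n *\<^sub>C fst (F n)) sums x" for x
      by (rule exI[where x = "\<lambda>n. cblinfun_apply (snd (F n)) x"])
        (rule F[unfolded complex_schauder_frame_def, rule_format])
  qed
  ultimately show False
    by (rule no_countable_dense_if_separated)
qed

theorem mainTheorem6:
  shows "((\<nexists>B :: 'h::{real_inner,banach} set. finite B \<and> span B = UNIV) \<longrightarrow>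
            (\<nexists>F :: nat \<Rightarrow> ('h \<Rightarrow>\<^sub>L 'h) \<times> (('h \<Rightarrow>\<^sub>L 'h) \<Rightarrow>\<^sub>L real). schauder_frame F))
       \<and> ((\<nexists>B :: 'k::chilbert_space set. finite B \<and> cspan B = UNIV) \<longrightarrow>
            (\<nexists>F :: nat \<Rightarrow> ('k \<Rightarrow>\<^sub>C\<^sub>L 'k) \<times> (('k \<Rightarrow>\<^sub>C\<^sub>L 'k) \<Rightarrow>\<^sub>C\<^sub>L complex). complex_schauder_frame F))"
proof (rule conjI; rule impI; rule notI)
  assume inf_dim: "\<nexists>B :: 'h set. finite B \<and> span B = UNIV"
  assume "\<exists>F :: nat \<Rightarrow> ('h \<Rightarrow>\<^sub>L 'h) \<times> (('h \<Rightarrow>\<^sub>L 'h) \<Rightarrow>\<^sub>L real). schauder_frame F"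
  then show False
    by (elim exE) (rule no_real_schauder_frame[OF inf_dim])
next
  assume inf_dim: "\<nexists>B :: 'k set. finite B \<and> cspan B = UNIV"
  assume "\<exists>F :: nat \<Rightarrow> ('k \<Rightarrow>\<^sub>C\<^sub>L 'k) \<times> (('k \<Rightarrow>\<^sub>C\<^sub>L 'k) \<Rightarrow>\<^sub>C\<^sub>L complex). complex_schauder_frame F"
  then show False
    by (elim exE) (rule no_complex_schauder_frame[OF inf_dim])
qed

end
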